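(* For all non-negative integers $m$ and $n$, the box polynomial $B_{m,n}(x)$ is given by the last column of the excedance matrix $M(m,n)$: $$B_{m,n}(x)=\sum_{j=0}^{m}c^{m,n}_{j,n}\cdot x^{j}.$$
   Context: For non-negative integers $m,n$, the box polynomial is $$B_{m,n}(x)=\sum_{\lambda\subseteq m\times n}\ \prod_{i=1}^{m}(x+\lambda_i),$$ where the sum is over all integer sequences (partitions) $\lambda=(n\ge\lambda_1\ge\lambda_2\ge\cdots\ge\lambda_m\ge 0)$, i.e. partitions with $m$ non-negative parts, each at most $n$ (an empty product is $1$). The excedance algebra is the quotient $\mathbb{Z}\langle \mathbf{a},\mathbf{b}\rangle/(\mathbf{b}\mathbf{a}-\mathbf{a}\mathbf{b}-\mathbf{a}-\mathbf{b})$ of the free associative unital ring on two non-commuting variables $\mathbf{a},\mathbf{b}$ by the two-sided ideal generated by $\mathbf{b}\mathbf{a}-\mathbf{a}\mathbf{b}-\mathbf{a}-\mathbf{b}$; the monomials $\{\mathbf{a}^{i}\mathbf{b}^{j}\}_{i,j\ge 0}$ form a $\mathbb{Z}$-basis of it (the standard basis). Let $E(m,n)$ be the image in the excedance algebra of the sum of all words in $\mathbf{a},\mathbf{b}$ with exactly $m$ letters $\mathbf{a}$ and $n$ letters $\mathbf{b}$. The integers $c^{m,n}_{i,j}$ are defined by the expansion $$E(m,n)=\sum_{0\le i\le m,\ 0\le j\le n}c^{m,n}_{i,j}\cdot\mathbf{a}^{i}\mathbf{b}^{j}.$$ The excedance matrix $M(m,n)$ is the $(m+1)\times(n+1)$ matrix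 with $(i,j)$ entry $c^{m,n}_{i,j}$, for $0\le i\le m$, $0\le j\le n$. *)

theory Defs
  imports
    "HOL-Library.Poly_Mapping"
    "HOL-Computational_Algebra.Polynomial"
    "Jordan_Normal_Form.Matrix"
begin

section \<open>Box polynomials\<close>

definition box_partitions :: "nat \<Rightarrow> nat \<Rightarrow> nat list set" where
  "box_partitions m n = {p. length p = m \<and> sorted_wrt (\<ge>) p \<and> (\<forall>k \<in> set p. k \<le> n)}"

text \<open>The parts of \<open>p\<close> are indexed from 0, and \<open>[:c, 1:]\<close> is the linear polynomial \<open>x + c\<close>.\<close>

definition box_poly :: "nat \<Rightarrow> nat \<Rightarrow> int poly" where
  "box_poly m n = (\<Sum>p \<in> box_partitions m n. \<Prod>i<m. [:int (p ! i), 1:])"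


section \<open>The free associative ring\<close>

text \<open>Words under concatenation, written additively because the convolution product of
  \<open>poly_mapping\<close> is based on an additive monoid of exponents.  With integer coefficients this
  makes \<open>'x free_monoid \<Rightarrow>\<^sub>0 int\<close> the free associative unital ring on \<open>'x\<close>.\<close>

datatype 'x free_monoid = Word (letters: "'x list")

instantiation free_monoid :: (type) monoid_add
begin

definition zero_free_monoid :: "'a free_monoid" where
  "0 = Word []"

definition plus_free_monoid :: "'a free_monoid \<Rightarrow> 'a free_monoid \<Rightarrow> 'a free_monoid" where
  "v + w = Word (letters v @ letters w)"

instance
  by standard (simp_all add: zero_free_monoid_def plus_free_monoid_def)

end

datatype letter = La | Lb

type_synonym free_ring = "letter free_monoid \<Rightarrow>\<^sub>0 int"

definition word :: "letter list \<Rightarrow> free_ring" where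
  "word w = Poly_Mapping.single (Word w) 1"


section \<open>The excedance algebra\<close>

text \<open>The two-sided ideal generated by \<open>S\<close>; closure under negation follows from
  multiplication by \<open>-1\<close>.\<close>

inductive_set two_sided_ideal :: "'r::ring_1 set \<Rightarrow> 'r set" for S :: "'r set" where
  zero: "0 \<in> two_sided_ideal S"
| gen: "s \<in> S \<Longrightarrow> s \<in> two_sided_ideal S"
| add: "x \<in> two_sided_ideal S \<Longrightarrow> y \<in> two_sided_ideal S \<Longrightarrow> x + y \<in> two_sided_ideal S"
| mult_left: "x \<in> two_sided_ideal S \<Longrightarrow> r * x \<in> two_sided_ideal S"
| mult_right: "x \<in> two_sided_ideal S \<Longrightarrow> x * r \<in> two_sided_ideal S"

lemma two_sided_ideal_uminus: "x \<in> two_sided_ideal S \<Longrightarrow> - x \<in> two_sided_ideal S"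
  using two_sided_ideal.mult_left[of x S "-1"] by simp

lemma two_sided_ideal_diff:
  "x \<in> two_sided_ideal S \<Longrightarrow> y \<in> two_sided_ideal S \<Longrightarrow> x - y \<in> two_sided_ideal S"
  using two_sided_ideal.add[of x S "- y"] two_sided_ideal_uminus[of y S] by simp

definition excedance_ideal :: "free_ring set" where
  "excedance_ideal =
     two_sided_ideal {word [Lb] * word [La] - word [La] * word [Lb] - word [La] - word [Lb]}"

definition excedance_rel :: "free_ring \<Rightarrow> free_ring \<Rightarrow> bool" where
  "excedance_rel x y \<longleftrightarrow> x - y \<in> excedance_ideal"

quotient_type excedance_algebra = free_ring / excedance_rel
proof (rule equivpI)
  show "reflp excedance_rel"
    by (simp add: reflp_def excedance_rel_def excedance_ideal_def two_sided_ideal.zero)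
  show "symp excedance_rel"
    unfolding excedance_rel_def excedance_ideal_def
    using two_sided_ideal_uminus by (fastforce intro: sympI)
  show "transp excedance_rel"
    unfolding excedance_rel_def excedance_ideal_def
    using two_sided_ideal.add by (fastforce intro: transpI)
qed

text \<open>The constant coefficient is multiplicative and vanishes on the ideal, so the quotient is
  not the zero ring.\<close>

lemma zero_eq_plus_free_monoid_iff: "0 = v + w \<longleftrightarrow> v = 0 \<and> w = (0 :: 'x free_monoid)"
  by (cases v; cases w) (auto simp: zero_free_monoid_def plus_free_monoid_def)

lemma lookup_times_zero:
  fixes f g :: "'x free_monoid \<Rightarrow>\<^sub>0 int"
  shows "Poly_Mapping.lookup (f * g) 0 = Poly_Mapping.lookup f 0 * Poly_Mapping.lookup g 0"
proof -
  have inner: "Sum_any (\<lambda>q. Poly_Mapping.lookup g q when 0 = l + q) =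
      (Poly_Mapping.lookup g 0 when l = 0)" for l
    by (cases "l = 0") (simp_all add: zero_eq_plus_free_monoid_iff)
  have "Poly_Mapping.lookup (f * g) 0 = Sum_any (\<lambda>l. Poly_Mapping.lookup f l *
      Sum_any (\<lambda>q. Poly_Mapping.lookup g q when 0 = l + q))"
    by (simp only: lookup_mult)
  also have "\<dots> = Sum_any (\<lambda>l. Poly_Mapping.lookup f l * Poly_Mapping.lookup g 0 when l = 0)"
    by (simp only: inner mult_when)
  finally show ?thesis by simp
qed

lemma lookup_word_zero: "Poly_Mapping.lookup (word w) 0 = (1 when w = [])"
  by (auto simp: word_def lookup_single zero_free_monoid_def when_def)

lemma lookup_excedance_ideal_zero: "x \<in> excedance_ideal \<Longrightarrow> Poly_Mapping.lookup x 0 = 0"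
  unfolding excedance_ideal_def
  by (induction rule: two_sided_ideal.induct)
    (auto simp: lookup_add lookup_minus lookup_times_zero lookup_word_zero)

instantiation excedance_algebra :: ring_1
begin

lift_definition zero_excedance_algebra :: excedance_algebra is 0 .

lift_definition one_excedance_algebra :: excedance_algebra is 1 .

lift_definition plus_excedance_algebra ::
    "excedance_algebra \<Rightarrow> excedance_algebra \<Rightarrow> excedance_algebra" is "(+)"
  unfolding excedance_rel_def excedance_ideal_def
  by (simp only: add_diff_add two_sided_ideal.add)

lift_definition uminus_excedance_algebra :: "excedance_algebra \<Rightarrow> excedance_algebra" is uminus
  unfolding excedance_rel_def excedance_ideal_def
  by (drule two_sided_ideal_uminus) simp

lift_definition minus_excedance_algebra ::
    "excedance_algebra \<Rightarrow> excedance_algebra \<Rightarrow> excedance_algebra" is "(-)"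
  unfolding excedance_rel_def excedance_ideal_def
  by (drule (1) two_sided_ideal_diff) (simp add: algebra_simps)

lift_definition times_excedance_algebra ::
    "excedance_algebra \<Rightarrow> excedance_algebra \<Rightarrow> excedance_algebra" is "(*)"
proof -
  fix x x' y y' :: free_ring
  assume "excedance_rel x x'" "excedance_rel y y'"
  moreover have "x * y - x' * y' = (x - x') * y + x' * (y - y')"
    by (simp add: algebra_simps)
  ultimately show "excedance_rel (x * y) (x' * y')"
    unfolding excedance_rel_def excedance_ideal_def
    by (simp add: two_sided_ideal.add two_sided_ideal.mult_left two_sided_ideal.mult_right)
qed

instance
proof
  have "\<not> excedance_rel 0 1"
    using lookup_excedance_ideal_zero[of "- 1"] by (auto simp: excedance_rel_def lookup_one)
  then show "(0::excedance_algebra) \<noteq> 1"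
    by transfer
qed (transfer; simp add: algebra_simps excedance_rel_def excedance_ideal_def
      two_sided_ideal.zero)+

end

definition gen_a :: excedance_algebra where
  "gen_a = abs_excedance_algebra (word [La])"

definition gen_b :: excedance_algebra where
  "gen_b = abs_excedance_algebra (word [Lb])"

definition words_with :: "nat \<Rightarrow> nat \<Rightarrow> letter list set" where
  "words_with m n = {w. count_list w La = m \<and> count_list w Lb = n}"

definition excedance_sum :: "nat \<Rightarrow> nat \<Rightarrow> excedance_algebra" where
  "excedance_sum m n = abs_excedance_algebra (\<Sum>w \<in> words_with m n. word w)"

text \<open>The coefficients \<open>c\<^sup>m\<^sup>,\<^sup>n\<^sub>i\<^sub>,\<^sub>j\<close> of \<open>excedance_sum m n\<close> in the standard basis; the support
  condition only normalises the values outside the index range of the expansion.\<close>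

definition excedance_coeff :: "nat \<Rightarrow> nat \<Rightarrow> nat \<Rightarrow> nat \<Rightarrow> int" where
  "excedance_coeff m n =
     (THE c. (\<forall>i j. m < i \<or> n < j \<longrightarrow> c i j = 0) \<and>
             excedance_sum m n = (\<Sum>i=0..m. \<Sum>j=0..n. of_int (c i j) * (gen_a ^ i * gen_b ^ j)))"

definition excedance_matrix :: "nat \<Rightarrow> nat \<Rightarrow> int mat" where
  "excedance_matrix m n = mat (m + 1) (n + 1) (\<lambda>(i, j). excedance_coeff m n i j)"

end

theory Submission
  imports Defs
begin

text \<open>Write E(m,n) for \<open>excedance_sum m n\<close>. Splitting words by their first letter
  gives E(m,n) = a E(m-1,n) + b E(m,n-1) for m, n > 0 (\<open>excedance_sum_rec\<close>).
  Straightening b p(a) yields p(a+1) b plus a term free of b, so the coefficient T(m,n) of b^n in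
  E(m,n), a polynomial in a, satisfies T(m,n)(x) = x T(m-1,n)(x) + T(m,n-1)(x+1). Box polynomials
  obey the same recursion (\<open>box_poly_Suc_Suc\<close>): either the last part is zero and
  contributes a factor x, or all parts are positive and lowering them by one turns x into x + 1. The
  boundary values agree as well.

  It remains to see that the coefficients are well defined. Existence of the expansion is a
  straightening argument (\<open>excedance_sum_in_standard_span\<close>). For uniqueness, the
  excedance algebra is made to act on Z[a][b] (\<open>letter_act_commutator\<close>,
  \<open>act_excedance_ideal\<close>); there a^i b^j sends 1 to the monomial of the same name
  (\<open>normal_form_monomial\<close>), so applying an element to 1 reads off its
  coefficients.\<close>

definition shift :: "int poly \<Rightarrow> int poly" where
  "shift p = pcompose p [:1, 1:]"

lemma shift_simps [simp]:
  "shift 0 = 0" "shift 1 = 1"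
  "shift (p + q) = shift p + shift q" "shift (p - q) = shift p - shift q"
  "shift (p * q) = shift p * shift q" "shift [:c, 1:] = [:c + 1, 1:]"
  by (simp_all add: shift_def pcompose_add pcompose_diff pcompose_mult pcompose_pCons pcompose_1
      add.commute)

lemma shift_sum: "shift (sum f A) = (\<Sum>x\<in>A. shift (f x))"
  by (simp add: shift_def pcompose_sum)

subsection \<open>Box polynomials\<close>

lemma box_poly_eq_prod_list:
  "box_poly m n = (\<Sum>p\<in>box_partitions m n. \<Prod>k\<leftarrow>p. [:int k, 1:])"
  unfolding box_poly_def
  by (rule sum.cong) (auto simp: box_partitions_def prod.list_conv_set_nth atLeast0LessThan)

lemma finite_box_partitions: "finite (box_partitions m n)"
proof (rule finite_subset)
  show "box_partitions m n \<subseteq> {p. set p \<subseteq> {..n} \<and> length p = m}"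
    by (auto simp: box_partitions_def)
qed (simp add: finite_lists_length_eq)

lemma box_partitions_0_left: "box_partitions 0 n = {[]}"
  by (auto simp: box_partitions_def)

lemma box_partitions_0_right: "box_partitions m 0 = {replicate m 0}"
  by (auto simp: box_partitions_def sorted_wrt_iff_nth_less intro: replicate_eqI)

lemma box_poly_0_left: "box_poly 0 n = 1"
  by (simp add: box_poly_eq_prod_list box_partitions_0_left)

lemma box_poly_0_right: "box_poly m 0 = [:0, 1:] ^ m"
  by (simp add: box_poly_eq_prod_list box_partitions_0_right)

text \<open>The last part is the smallest: either it is zero and can be removed, or every part can
  be lowered by one.\<close>

lemma box_partitions_Suc_Suc:
  "box_partitions (Suc m) (Suc n) =
     (\<lambda>p. p @ [0]) ` box_partitions m (Suc n) \<union> map Suc ` box_partitions (Suc m) n"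
proof (intro Set.set_eqI iffI)
  fix p assume p: "p \<in> box_partitions (Suc m) (Suc n)"
  then obtain q k where q: "p = q @ [k]"
    by (cases p rule: rev_cases) (auto simp: box_partitions_def)
  show "p \<in> (\<lambda>p. p @ [0]) ` box_partitions m (Suc n) \<union> map Suc ` box_partitions (Suc m) n"
  proof (cases k)
    case 0
    with p q show ?thesis by (auto simp: box_partitions_def sorted_wrt_append)
  next
    case (Suc l)
    then have pos: "\<forall>x\<in>set p. x > 0"
      using p q by (fastforce simp: box_partitions_def sorted_wrt_append)
    then have "p = map Suc (map (\<lambda>x. x - 1) p)"
      by (simp add: map_idI)
    moreover have "map (\<lambda>x. x - 1) p \<in> box_partitions (Suc m) n"
      using p by (auto simp: box_partitions_def sorted_wrt_map
          elim!: sorted_wrt_mono_rel[rotated])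
    ultimately show ?thesis by blast
  qed
qed (auto simp: box_partitions_def sorted_wrt_append sorted_wrt_map)

lemma box_poly_Suc_Suc:
  "box_poly (Suc m) (Suc n) = [:0, 1:] * box_poly m (Suc n) + shift (box_poly (Suc m) n)"
proof -
  let ?f = "\<lambda>p. \<Prod>k\<leftarrow>p. [:int k, 1:]"
  have shift: "?f (map Suc p) = shift (?f p)" for p
    by (induction p) (simp_all add: add.commute del: mult_pCons_left mult_pCons_right)
  have "0 \<in> set (p @ [0])" "0 \<notin> set (map Suc q)" for p q :: "nat list"
    by auto
  then have disj: "(\<lambda>p. p @ [0]) ` box_partitions m (Suc n) \<inter> map Suc ` box_partitions (Suc m) n = {}"
    by (metis (no_types, lifting) disjoint_iff imageE)
  have "box_poly (Suc m) (Suc n) =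
      (\<Sum>p\<in>(\<lambda>p. p @ [0]) ` box_partitions m (Suc n). ?f p) +
      (\<Sum>p\<in>map Suc ` box_partitions (Suc m) n. ?f p)"
    unfolding box_poly_eq_prod_list box_partitions_Suc_Suc
    by (intro sum.union_disjoint finite_imageI finite_box_partitions disj)
  also have "\<dots> = (\<Sum>p\<in>box_partitions m (Suc n). ?f (p @ [0])) +
      (\<Sum>p\<in>box_partitions (Suc m) n. ?f (map Suc p))"
    by (subst (1 2) sum.reindex) (auto simp: inj_on_def o_def)
  also have "\<dots> = [:0, 1:] * box_poly m (Suc n) + shift (box_poly (Suc m) n)"
    unfolding shift by (simp add: box_poly_eq_prod_list shift_sum sum_distrib_left mult.commute
        del: mult_pCons_left mult_pCons_right)
  finally show ?thesis .
qed

subsection \<open>The action on normal forms\<close>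

text \<open>A normal form \<open>\<Sum> c\<^sub>i\<^sub>j a\<^sup>i b\<^sup>j\<close> is encoded as a polynomial in \<open>b\<close> over the polynomials
  in \<open>a\<close>.  Since \<open>(a + b) a = (a + 1) (a + b)\<close>, left multiplication by \<open>b\<close> satisfies
  \<open>b p(a) = p(a + 1) b + a (p(a + 1) - p(a))\<close>.\<close>

fun letter_act :: "letter \<Rightarrow> int poly poly \<Rightarrow> int poly poly" where
  "letter_act La F = Polynomial.smult [:0, 1:] F"
| "letter_act Lb F = pCons 0 (map_poly shift F) + Polynomial.smult [:0, 1:] (map_poly shift F - F)"

lemma coeff_letter_act_b:
  "coeff (letter_act Lb F) k =
     (case k of 0 \<Rightarrow> 0 | Suc l \<Rightarrow> shift (coeff F l)) + [:0, 1:] * (shift (coeff F k) - coeff F k)"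
  by (cases k) (simp_all add: coeff_map_poly)

lemma letter_act_add: "letter_act l (F + G) = letter_act l F + letter_act l G"
  by (cases l)
    (simp_all add: smult_add_right poly_eq_iff[where 'a = "int poly"] coeff_letter_act_b algebra_simps
      del: letter_act.simps(2) mult_pCons_left mult_pCons_right split: nat.split)

text \<open>This is the defining relation of the algebra as an identity of operators; it holds
  because shifting the variable a gives a + 1.\<close>

lemma letter_act_commutator:
  "letter_act Lb (letter_act La F) - letter_act La (letter_act Lb F) =
     letter_act La F + letter_act Lb F"
proof (rule poly_eqI)
  fix k
  have one: "[:1, 1:] = [:0, 1:] + (1 :: int poly)"
    by (simp add: one_pCons)
  show "coeff (letter_act Lb (letter_act La F) - letter_act La (letter_act Lb F)) k =
      coeff (letter_act La F + letter_act Lb F) k"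
    by (cases k) (simp_all add: coeff_letter_act_b algebra_simps one
      del: letter_act.simps(2) mult_pCons_left mult_pCons_right)
qed

section \<open>The module structure over the free ring and its descent to the quotient\<close>

definition word_act :: "letter free_monoid \<Rightarrow> int poly poly \<Rightarrow> int poly poly" where
  "word_act w = foldr letter_act (letters w)"

lemma additive_word_act: "additive (word_act w)"
proof -
  have "foldr letter_act ls (F + G) = foldr letter_act ls F + foldr letter_act ls G" for ls F G
    by (induction ls) (simp_all add: letter_act_add)
  then show ?thesis by (simp add: additive_def word_act_def)
qed

definition act :: "free_ring \<Rightarrow> int poly poly \<Rightarrow> int poly poly" where
  "act f F = (\<Sum>w\<in>Poly_Mapping.keys f. of_int (Poly_Mapping.lookup f w) * word_act w F)"

lemma act_superset:
  assumes "finite S" "Poly_Mapping.keys f \<subseteq> S"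
  shows "act f F = (\<Sum>w\<in>S. of_int (Poly_Mapping.lookup f w) * word_act w F)"
  unfolding act_def using assms
  by (intro sum.mono_neutral_left) (auto simp: in_keys_iff)

lemma act_diff: "act (f - g) F = act f F - act g F"
proof -
  let ?S = "Poly_Mapping.keys f \<union> Poly_Mapping.keys g"
  have "act h F = (\<Sum>w\<in>?S. of_int (Poly_Mapping.lookup h w) * word_act w F)"
    if "h \<in> {f, g, f - g}" for h
    using that keys_diff[of f g] by (intro act_superset) auto
  then show ?thesis
    by (simp add: lookup_minus algebra_simps sum_subtractf)
qed

lemma act_zero: "act 0 F = 0"
  by (simp add: act_def)

lemma act_add: "act (f + g) F = act f F + act g F"
  using act_diff[of "f + g" g F] by (simp add: eq_diff_eq)

lemma act_frag_of: "act (Poly_Mapping.single w 1) F = word_act w F"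
  by (simp add: act_def)

lemma act_diff_right: "act f (F - G) = act f F - act f G"
  by (simp add: act_def additive.diff[OF additive_word_act] algebra_simps sum_subtractf)

lemma act_zero_right: "act f 0 = 0"
  using act_diff_right[of f 0 0] by simp

lemma word_act_plus: "word_act (v + w) F = word_act v (word_act w F)"
  by (simp add: word_act_def plus_free_monoid_def)

text \<open>Additively the free ring is a free abelian group on words, so
  \<open>frag_induction\<close> leaves only single words and differences to check.\<close>

lemma act_frag_of_mult: "act (Poly_Mapping.single v 1 * g) F = word_act v (act g F)"
  using subset_UNIV[of "Poly_Mapping.keys g"]
proof (induction g rule: frag_induction)
  case (diff g h)
  then show ?case
    by (simp add: right_diff_distrib act_diff additive.diff[OF additive_word_act])
qed (simp_all add: act_zero mult_single act_frag_of word_act_plus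
    additive.zero[OF additive_word_act])

lemma act_mult: "act (f * g) F = act f (act g F)"
  using subset_UNIV[of "Poly_Mapping.keys f"]
proof (induction f rule: frag_induction)
  case (diff f h)
  then show ?case
    by (simp add: left_diff_distrib act_diff)
qed (simp_all add: act_zero act_frag_of act_frag_of_mult)

lemma act_word: "act (word ls) F = foldr letter_act ls F"
  by (simp add: word_def act_frag_of word_act_def)

lemma act_excedance_ideal: "f \<in> excedance_ideal \<Longrightarrow> act f F = 0"
  unfolding excedance_ideal_def
\<comment> \<open>The vector \<open>F\<close> must vary: a right multiple x * r acts on
  \<open>F\<close> as x acts on \<open>act r F\<close>.\<close>
proof (induction arbitrary: F rule: two_sided_ideal.induct)
  case (gen f)
  then show ?case
    using letter_act_commutator[of F]
    by (simp add: act_diff act_mult act_word del: letter_act.simps)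
qed (simp_all add: act_zero act_add act_mult act_zero_right)

text \<open>The orbit map u -> u . 1 of the module, which serves as a coordinate map for the
  standard basis.\<close>

lift_definition normal_form :: "excedance_algebra \<Rightarrow> int poly poly" is "\<lambda>f. act f 1"
  using act_excedance_ideal by (fastforce simp: excedance_rel_def act_diff)

lemma additive_normal_form: "additive normal_form"
  unfolding additive_def by (intro allI, transfer) (rule act_add)

lemma normal_form_one: "normal_form 1 = 1"
  by transfer (simp add: act_frag_of word_act_def zero_free_monoid_def flip: single_one)

lemma normal_form_gen_a_mult: "normal_form (gen_a * u) = letter_act La (normal_form u)"
  unfolding gen_a_def
  by (induction u rule: excedance_algebra.abs_induct)
    (simp add: times_excedance_algebra.abs_eq normal_form.abs_eq act_mult act_word)

lemma normal_form_gen_b_mult: "normal_form (gen_b * u) = letter_act Lb (normal_form u)"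
  unfolding gen_b_def
  by (induction u rule: excedance_algebra.abs_induct)
    (simp add: times_excedance_algebra.abs_eq normal_form.abs_eq act_mult act_word)

lemma normal_form_of_int_mult: "normal_form (of_int c * u) = of_int c * normal_form u"
proof -
  interpret additive normal_form by (rule additive_normal_form)
  have nat: "normal_form (of_nat k * u) = of_nat k * normal_form u" for k
    by (induction k) (simp_all add: zero add distrib_right)
  show ?thesis
    by (cases c) (simp_all add: nat minus del: of_nat_Suc)
qed

text \<open>On polynomials in b with constant coefficients the shift is trivial, so b acts as plain
  multiplication by b; a always acts as a scalar. Linear independence of the a^i b^j
  follows.\<close>

lemma normal_form_monomial: "normal_form (gen_a ^ i * gen_b ^ j) = monom (monom 1 i) j"
proof (induction i)
  case 0
  show ?case
  proof (induction j)
    case (Suc j)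
    then show ?case
      by (simp add: normal_form_gen_b_mult map_poly_monom monom_Suc flip: one_pCons)
  qed (simp add: normal_form_one)
next
  case (Suc i)
  then show ?case
    by (simp add: mult.assoc normal_form_gen_a_mult smult_monom monom_Suc)
qed

text \<open>Uniqueness of the expansion. The outer coefficient index is the power of b, the inner
  one the power of a.\<close>

lemma coeff_normal_form_expansion:
  assumes supp: "\<forall>i j. m < i \<or> n < j \<longrightarrow> c i j = 0"
    and u: "u = (\<Sum>i=0..m. \<Sum>j=0..n. of_int (c i j) * (gen_a ^ i * gen_b ^ j))"
  shows "coeff (coeff (normal_form u) l) k = c k l"
proof -
  interpret additive normal_form by (rule additive_normal_form)
  have "coeff (coeff (normal_form u) l) k =
      (\<Sum>i=0..m. \<Sum>j=0..n. coeff (coeff (of_int (c i j) * monom (monom 1 i) j) l) k)"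
    by (simp add: u sum normal_form_of_int_mult normal_form_monomial coeff_sum)
  also have "\<dots> = (\<Sum>i=0..m. \<Sum>j=0..n. if j = l then if i = k then c i j else 0 else 0)"
    by (intro sum.cong refl) (simp add: of_int_poly smult_monom)
  also have "\<dots> = c k l"
    using supp by (cases "l \<le> n") (auto simp: sum.delta)
  finally show ?thesis .
qed

subsection \<open>Expansion in the standard basis\<close>

text \<open>Sums of monomials suffice, since rewriting ba as ab + a + b creates no negative terms.
  The parameters bound the exponents of a and b.\<close>

inductive_set standard_span :: "nat \<Rightarrow> nat \<Rightarrow> excedance_algebra set" for m n where
  monomial: "i \<le> m \<Longrightarrow> j \<le> n \<Longrightarrow> gen_a ^ i * gen_b ^ j \<in> standard_span m n"
| add: "u \<in> standard_span m n \<Longrightarrow> v \<in> standard_span m n \<Longrightarrow> u + v \<in> standard_span m n"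

lemma standard_span_expansion:
  assumes "u \<in> standard_span m n"
  shows "\<exists>c. (\<forall>i j. m < i \<or> n < j \<longrightarrow> c i j = 0) \<and>
    u = (\<Sum>i=0..m. \<Sum>j=0..n. of_int (c i j) * (gen_a ^ i * gen_b ^ j))"
  using assms
proof induction
  case (monomial k l)
  have "(\<Sum>i=0..m. \<Sum>j=0..n. of_int (if j = l then if i = k then 1 else 0 else 0) *
      (gen_a ^ i * gen_b ^ j)) =
    (\<Sum>i=0..m. \<Sum>j=0..n. if j = l then if i = k then gen_a ^ i * gen_b ^ j else 0 else 0)"
    by (intro sum.cong refl) simp
  also have "\<dots> = gen_a ^ k * gen_b ^ l"
    using monomial by (simp add: sum.delta)
  finally show ?case
    using monomial
    by (intro exI[of _ "\<lambda>i j. if j = l then if i = k then 1 else 0 else 0"]) auto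
next
  case (add u v)
  then obtain c d where
    "\<forall>i j. m < i \<or> n < j \<longrightarrow> c i j = 0"
    "u = (\<Sum>i=0..m. \<Sum>j=0..n. of_int (c i j) * (gen_a ^ i * gen_b ^ j))"
    "\<forall>i j. m < i \<or> n < j \<longrightarrow> d i j = 0"
    "v = (\<Sum>i=0..m. \<Sum>j=0..n. of_int (d i j) * (gen_a ^ i * gen_b ^ j))"
    by blast
  then show ?case
    by (intro exI[of _ "\<lambda>i j. c i j + d i j"]) (simp add: sum.distrib distrib_right)
qed

lemma standard_span_mono:
  assumes "u \<in> standard_span m n" "m \<le> m'" "n \<le> n'"
  shows "u \<in> standard_span m' n'"
  using assms by induction (auto intro: standard_span.intros)

lemma gen_a_mult_standard_span:
  "u \<in> standard_span m n \<Longrightarrow> gen_a * u \<in> standard_span (Suc m) n"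
proof (induction rule: standard_span.induct)
  case (monomial i j)
  then show ?case
    using standard_span.monomial[of "Suc i" "Suc m" j n] by (simp add: mult.assoc)
qed (simp add: distrib_left standard_span.add)

lemma gen_b_mult_gen_a: "gen_b * gen_a = gen_a * gen_b + gen_a + gen_b"
proof -
  let ?a = "word [La]" and ?b = "word [Lb]"
  have "excedance_rel (?b * ?a) (?a * ?b + ?a + ?b)"
    unfolding excedance_rel_def excedance_ideal_def
    using two_sided_ideal.gen[of "?b * ?a - ?a * ?b - ?a - ?b"] by (simp add: algebra_simps)
  then show ?thesis
    by (simp add: gen_a_def gen_b_def times_excedance_algebra.abs_eq
        plus_excedance_algebra.abs_eq excedance_algebra.abs_eq_iff)
qed

text \<open>Moving b to the right past one a either keeps both letters or loses one of them, so the
  exponent of a never grows and that of b grows by at most one.\<close>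

lemma gen_b_mult_monomial: "gen_b * (gen_a ^ i * gen_b ^ j) \<in> standard_span i (Suc j)"
proof (induction i)
  case 0
  show ?case
    using standard_span.monomial[of 0 0 "Suc j" "Suc j"] by simp
next
  case (Suc i)
  let ?u = "gen_a ^ i * gen_b ^ j"
  have "gen_b * (gen_a ^ Suc i * gen_b ^ j) = gen_b * gen_a * ?u"
    by (simp add: mult.assoc)
  also have "\<dots> = gen_a * (gen_b * ?u) + gen_a * ?u + gen_b * ?u"
    by (simp add: gen_b_mult_gen_a distrib_right mult.assoc)
  also have "\<dots> \<in> standard_span (Suc i) (Suc j)"
    using Suc
    by (intro standard_span.add gen_a_mult_standard_span)
      (auto intro: standard_span_mono standard_span.monomial)
  finally show ?case .
qed

lemma gen_b_mult_standard_span: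
  "u \<in> standard_span m n \<Longrightarrow> gen_b * u \<in> standard_span m (Suc n)"
proof (induction rule: standard_span.induct)
  case (monomial i j)
  then show ?case
    using standard_span_mono[OF gen_b_mult_monomial] by simp
qed (simp add: distrib_left standard_span.add)

section \<open>Recursion for E(m,n) by the first letter\<close>

lemma excedance_sum_eq: "excedance_sum m n = (\<Sum>w\<in>words_with m n. abs_excedance_algebra (word w))"
proof -
  have "additive abs_excedance_algebra"
    by (simp add: additive_def plus_excedance_algebra.abs_eq)
  then show ?thesis
    unfolding excedance_sum_def by (rule additive.sum)
qed

lemma abs_word_Cons:
  "abs_excedance_algebra (word (l # w)) =
     (case l of La \<Rightarrow> gen_a | Lb \<Rightarrow> gen_b) * abs_excedance_algebra (word w)"
  by (simp add: word_def gen_a_def gen_b_def times_excedance_algebra.abs_eq mult_single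
      plus_free_monoid_def split: letter.split)

lemma abs_word_Nil: "abs_excedance_algebra (word []) = 1"
  by (simp add: word_def one_excedance_algebra_def flip: zero_free_monoid_def)

lemma words_with_0_0: "words_with 0 0 = {[]}"
proof -
  have "w = []" if "count_list w La = 0" "count_list w Lb = 0" for w
    using that by (cases w; cases "hd w") auto
  then show ?thesis by (auto simp: words_with_def)
qed

text \<open>The guards keep truncated subtraction harmless, so that one statement also covers words
  in a single letter.\<close>

lemma words_with_split:
  assumes "m + n > 0"
  shows "words_with m n =
    (if m > 0 then (#) La ` words_with (m - 1) n else {}) \<union>
    (if n > 0 then (#) Lb ` words_with m (n - 1) else {})"
proof (intro Set.set_eqI)
  fix w
  show "w \<in> words_with m n \<longleftrightarrow> w \<in>
    (if m > 0 then (#) La ` words_with (m - 1) n else {}) \<union>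
    (if n > 0 then (#) Lb ` words_with m (n - 1) else {})"
  proof (cases w)
    case Nil
    with assms show ?thesis by (auto simp: words_with_def)
  next
    case (Cons l v)
    with assms show ?thesis by (cases l) (auto simp: words_with_def image_iff)
  qed
qed

lemma finite_words_with: "finite (words_with m n)"
proof (induction "m + n" arbitrary: m n)
  case 0
  then show ?case by (simp add: words_with_0_0)
next
  case (Suc k)
  then show ?case
    by (subst words_with_split) auto
qed

lemma excedance_sum_0_0: "excedance_sum 0 0 = 1"
  by (simp add: excedance_sum_eq words_with_0_0 abs_word_Nil)

lemma excedance_sum_rec:
  assumes "m + n > 0"
  shows "excedance_sum m n =
    (if m > 0 then gen_a * excedance_sum (m - 1) n else 0) +
    (if n > 0 then gen_b * excedance_sum m (n - 1) else 0)"
proof -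
  have Cons: "(\<Sum>w\<in>(#) l ` words_with i j. abs_excedance_algebra (word w)) =
      (case l of La \<Rightarrow> gen_a | Lb \<Rightarrow> gen_b) * excedance_sum i j" for l i j
    by (subst sum.reindex) (simp_all add: excedance_sum_eq abs_word_Cons sum_distrib_left)
  have "excedance_sum m n =
    (\<Sum>w\<in>(if m > 0 then (#) La ` words_with (m - 1) n else {}). abs_excedance_algebra (word w)) +
    (\<Sum>w\<in>(if n > 0 then (#) Lb ` words_with m (n - 1) else {}). abs_excedance_algebra (word w))"
    unfolding excedance_sum_eq[of m n] words_with_split[OF assms]
    by (rule sum.union_disjoint) (auto simp: finite_words_with)
  then show ?thesis
    by (simp add: Cons)
qed

lemma excedance_sum_in_standard_span: "excedance_sum m n \<in> standard_span m n"
proof (induction "m + n" arbitrary: m n)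
  case 0
  then show ?case
    using standard_span.monomial[of 0 0 0 0] by (simp add: excedance_sum_0_0)
next
  case (Suc k)
  have "gen_a * excedance_sum (m - 1) n \<in> standard_span m n" if "m > 0"
    using gen_a_mult_standard_span[OF Suc(1)[of "m - 1" n]] that Suc(2) by simp
  moreover have "gen_b * excedance_sum m (n - 1) \<in> standard_span m n" if "n > 0"
    using gen_b_mult_standard_span[OF Suc(1)[of m "n - 1"]] that Suc(2) by simp
  moreover have "m + n > 0"
    using Suc(2) by linarith
  ultimately show ?case
    by (subst excedance_sum_rec) (auto intro: standard_span.add)
qed

text \<open>Existence from the span and uniqueness from the normal form justify the definite
  description.\<close>

lemma excedance_coeff_eq:
  "excedance_coeff m n i j = coeff (coeff (normal_form (excedance_sum m n)) j) i"
  and excedance_coeff_eq_0: "m < i \<or> n < j \<Longrightarrow> excedance_coeff m n i j = 0"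
proof -
  let ?P = "\<lambda>c. (\<forall>i j. m < i \<or> n < j \<longrightarrow> c i j = 0) \<and>
    excedance_sum m n = (\<Sum>i=0..m. \<Sum>j=0..n. of_int (c i j) * (gen_a ^ i * gen_b ^ j))"
  have coeff: "coeff (coeff (normal_form (excedance_sum m n)) j) i = c i j" if "?P c" for c i j
    using that coeff_normal_form_expansion by blast
  obtain c where "?P c"
    using standard_span_expansion[OF excedance_sum_in_standard_span] by blast
  moreover have "d = c" if "?P d" for d
    using coeff[OF that] coeff[OF \<open>?P c\<close>] by (intro ext) metis
  ultimately have P: "?P (excedance_coeff m n)"
    unfolding excedance_coeff_def by (rule theI)
  show "excedance_coeff m n i j = coeff (coeff (normal_form (excedance_sum m n)) j) i"
    using coeff[OF P] by simp
  show "excedance_coeff m n i j = 0" if "m < i \<or> n < j"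
    using P that by blast
qed

subsection \<open>The last column\<close>

lemma coeff_normal_form_excedance_sum_eq_0:
  "n < j \<Longrightarrow> coeff (normal_form (excedance_sum m n)) j = 0"
  using excedance_coeff_eq_0[of m _ n j] by (simp add: poly_eq_iff excedance_coeff_eq)

text \<open>Modulo lower powers of \<open>b\<close>, moving \<open>b\<close> to the right past \<open>p(a)\<close> only shifts \<open>p\<close>, so the
  coefficients of \<open>b\<^sup>n\<close> obey the recursion that box polynomials obey by splitting off a last part
  equal to zero.\<close>

lemma coeff_normal_form_excedance_sum:
  "coeff (normal_form (excedance_sum m n)) n = box_poly m n"
proof (induction "m + n" arbitrary: m n)
  case 0
  then show ?case
    by (simp add: excedance_sum_0_0 normal_form_one box_poly_0_left)
next
  case (Suc k)
  interpret additive normal_form by (rule additive_normal_form)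
  have pos: "m + n > 0"
    using Suc(2) by linarith
  have a: "coeff (normal_form (gen_a * excedance_sum (m - 1) n)) n = [:0, 1:] * box_poly (m - 1) n"
    if "m > 0"
    using Suc(1)[of "m - 1" n] Suc(2) that by (simp add: normal_form_gen_a_mult)
  \<comment> \<open>The correction term a (p(a+1) - p(a)) takes for p the coefficient of b^n in
    E(m,n-1), which is zero.\<close>
  have b: "coeff (normal_form (gen_b * excedance_sum m (n - 1))) n = shift (box_poly m (n - 1))"
    if "n > 0"
    using Suc(1)[of m "n - 1"] Suc(2) that
      coeff_normal_form_excedance_sum_eq_0[of "n - 1" n m]
    by (cases n) (simp_all add: normal_form_gen_b_mult coeff_letter_act_b del: letter_act.simps)
  have rec: "coeff (normal_form (excedance_sum m n)) n =
      (if m > 0 then [:0, 1:] * box_poly (m - 1) n else 0) +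
      (if n > 0 then shift (box_poly m (n - 1)) else 0)"
    using a b excedance_sum_rec[OF pos] by (auto simp: add zero simp del: mult_pCons_left)
  show ?case
    unfolding rec using Suc(2)
    \<comment> \<open>On the boundary the recursion reads x^m = x * x^(m-1) for n = 0, and says that
      the shift fixes 1 for m = 0.\<close>
    by (cases m; cases n)
      (simp_all add: box_poly_0_left box_poly_0_right box_poly_Suc_Suc)
qed

theorem proposition8p4:
  fixes m n :: nat
  shows "(\<forall>j\<le>m. col (excedance_matrix m n) n $ j = excedance_coeff m n j n) \<and>
         box_poly m n = (\<Sum>j=0..m. monom (excedance_coeff m n j n) j)"
proof
  show "\<forall>j\<le>m. col (excedance_matrix m n) n $ j = excedance_coeff m n j n"
    by (simp add: excedance_matrix_def)
  have "coeff (box_poly m n) i = excedance_coeff m n i n" for i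
    by (simp add: excedance_coeff_eq coeff_normal_form_excedance_sum)
  then show "box_poly m n = (\<Sum>j=0..m. monom (excedance_coeff m n j n) j)"
    \<comment> \<open>For exponents above m both sides have coefficient zero.\<close>
    using excedance_coeff_eq_0[of m _ n n] by (auto simp: poly_eq_iff coeff_sum)
qed

end
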